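(* Let $k$ be a nonnegative integer. If $k$ is not a power of two, then $*k$ is strongly decomposable and the only strong decompositions of $*k$ are sums of nimbers.
   Context: All games are short (finite) two-player partizan combinatorial games under normal play (a player who cannot move loses). $+$ denotes the disjunctive sum, and $=$ denotes the usual equality of game values. For a nonnegative integer $k$, the nimber $*k$ is the game $\{*0,\ldots,*(k-1)\mid *0,\ldots,*(k-1)\}$, with $*0=0$. Powers of two are the integers $2^n$ with $n$ a nonnegative integer. The birthday $b(G)$ is the height of the game tree of the canonical form of $G$. A game $G$ is strongly decomposable if there are games $H$ and $J$, both different from zero (as game values), such that $b(H)+b(J)=b(G)$ and $G=H+J$. Such an expression $G=H+J$ is called a strong decomposition of $G$; it is a sum of nimbers if both $H$ and $J$ are equal to nimbers.
   Formalization: The claim that *k is strongly decomposable is stated only for k different from 0: 0 is not a power of two, yet *0 = 0 has no strong decomposition, since birthdays summing to 0 force both summands to be zero. *)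

theory Defs
  imports Main "HOL-Library.FSet"
begin

text \<open>Short partizan games as formal objects: a game is given by its finite sets of
  Left and Right options. Equality of this type is identity of forms; equality of
  game values is \<open>game_eq\<close> below.\<close>

datatype game = Game (lopts: "game fset") (ropts: "game fset")

lemma size_lopts [termination_simp]: "x |\<in>| lopts G \<Longrightarrow> size x < size G"
proof (cases G)
  case (Game L R)
  assume "x |\<in>| lopts G"
  then show ?thesis
    using member_le_sum[of x "fset L" "\<lambda>x. Suc (size x)"] by (simp add: Game)
qed

lemma size_ropts [termination_simp]: "x |\<in>| ropts G \<Longrightarrow> size x < size G"
proof (cases G)
  case (Game L R)
  assume "x |\<in>| ropts G"
  then show ?thesis
    using member_le_sum[of x "fset R" "\<lambda>x. Suc (size x)"] by (simp add: Game)
qed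

definition zero_game :: game where
  "zero_game = Game {||} {||}"

fun add :: "game \<Rightarrow> game \<Rightarrow> game" (infixl "\<oplus>" 65) where
  "G \<oplus> H = Game ((\<lambda>G'. G' \<oplus> H) |`| lopts G |\<union>| (\<lambda>H'. G \<oplus> H') |`| lopts H)
               ((\<lambda>G'. G' \<oplus> H) |`| ropts G |\<union>| (\<lambda>H'. G \<oplus> H') |`| ropts H)"

declare add.simps [simp del]

fun nimber :: "nat \<Rightarrow> game" where
  "nimber k = Game (fset_of_list (map nimber [0..<k])) (fset_of_list (map nimber [0..<k]))"

declare nimber.simps [simp del]

text \<open>Normal play: the player to move wins iff some move leads to a position from which
  the opponent, moving first, does not win. In particular a player who cannot move loses.\<close>

fun left_wins_first :: "game \<Rightarrow> bool" and right_wins_first :: "game \<Rightarrow> bool" where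
  "left_wins_first G \<longleftrightarrow> fBex (lopts G) (\<lambda>G'. \<not> right_wins_first G')"
| "right_wins_first G \<longleftrightarrow> fBex (ropts G) (\<lambda>G'. \<not> left_wins_first G')"

declare left_wins_first.simps [simp del] right_wins_first.simps [simp del]

text \<open>The outcome order (most favourable to Left on top), with the first-player-win and
  second-player-win outcomes incomparable, is the componentwise order of the pairs
  (Left wins moving first, Right does not win moving first). The order and equality of
  games compare outcomes in every disjunctive sum.\<close>

definition outcome_le :: "game \<Rightarrow> game \<Rightarrow> bool" where
  "outcome_le G H \<longleftrightarrow>
     (left_wins_first G \<longrightarrow> left_wins_first H) \<and> (right_wins_first H \<longrightarrow> right_wins_first G)"

definition game_le :: "game \<Rightarrow> game \<Rightarrow> bool" (infix "\<lesssim>" 50) where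
  "G \<lesssim> H \<longleftrightarrow> (\<forall>X. outcome_le (G \<oplus> X) (H \<oplus> X))"

definition game_eq :: "game \<Rightarrow> game \<Rightarrow> bool" (infix "\<approx>" 50) where
  "G \<approx> H \<longleftrightarrow>
     (\<forall>X. (left_wins_first (G \<oplus> X) \<longleftrightarrow> left_wins_first (H \<oplus> X)) \<and>
          (right_wins_first (G \<oplus> X) \<longleftrightarrow> right_wins_first (H \<oplus> X)))"

definition left_dominated :: "game \<Rightarrow> game \<Rightarrow> bool" where
  "left_dominated G A \<longleftrightarrow> A |\<in>| lopts G \<and> (\<exists>B. B |\<in>| lopts G \<and> B \<noteq> A \<and> A \<lesssim> B)"

definition right_dominated :: "game \<Rightarrow> game \<Rightarrow> bool" where
  "right_dominated G A \<longleftrightarrow> A |\<in>| ropts G \<and> (\<exists>B. B |\<in>| ropts G \<and> B \<noteq> A \<and> B \<lesssim> A)"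

definition left_reversible :: "game \<Rightarrow> game \<Rightarrow> bool" where
  "left_reversible G A \<longleftrightarrow> A |\<in>| lopts G \<and> (\<exists>B. B |\<in>| ropts A \<and> B \<lesssim> G)"

definition right_reversible :: "game \<Rightarrow> game \<Rightarrow> bool" where
  "right_reversible G A \<longleftrightarrow> A |\<in>| ropts G \<and> (\<exists>B. B |\<in>| lopts A \<and> G \<lesssim> B)"

fun canonical :: "game \<Rightarrow> bool" where
  "canonical G \<longleftrightarrow>
     (\<nexists>A. left_dominated G A) \<and> (\<nexists>A. right_dominated G A) \<and>
     (\<nexists>A. left_reversible G A) \<and> (\<nexists>A. right_reversible G A) \<and>
     fBall (lopts G) canonical \<and> fBall (ropts G) canonical"

declare canonical.simps [simp del]

text \<open>Every game has exactly one canonical form: as option sets are genuine sets,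
  uniqueness up to identity of forms is uniqueness for HOL equality.\<close>

definition canonical_form :: "game \<Rightarrow> game" where
  "canonical_form G = (THE K. canonical K \<and> K \<approx> G)"

fun height :: "game \<Rightarrow> nat" where
  "height G = Max (insert 0 (fset ((\<lambda>G'. Suc (height G')) |`| (lopts G |\<union>| ropts G))))"

declare height.simps [simp del]

definition birthday :: "game \<Rightarrow> nat" where
  "birthday G = height (canonical_form G)"

definition strong_decomposition :: "game \<Rightarrow> game \<Rightarrow> game \<Rightarrow> bool" where
  "strong_decomposition G H J \<longleftrightarrow>
     \<not> H \<approx> zero_game \<and> \<not> J \<approx> zero_game \<and>
     birthday H + birthday J = birthday G \<and> G \<approx> H \<oplus> J"

definition strongly_decomposable :: "game \<Rightarrow> bool" where
  "strongly_decomposable G \<longleftrightarrow> (\<exists>H J. strong_decomposition G H J)"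

definition equals_nimber :: "game \<Rightarrow> bool" where
  "equals_nimber G \<longleftrightarrow> (\<exists>m. G \<approx> nimber m)"

end

theory Submission
  imports Defs
begin

text \<open>
  Suppose \<open>H + J = *k\<close> and the tree of \<open>H + J\<close> has height at most \<open>i + 2\<close>, where \<open>i < k\<close>. Some Left
  option of \<open>H + J\<close> is at least \<open>*i\<close>; if it were not equal to \<open>*i\<close>, it would be reversible through a
  position in which Left still has to reach \<open>*i\<close>, and the tree would be too high. So \<open>*i\<close> itself is
  a Left option, say \<open>A + J = *i\<close> with \<open>A\<close> a Left option of \<open>H\<close>.

  Induct on \<open>k\<close>. If \<open>k - 1\<close> is not a power of two, take \<open>i = k - 1\<close>: the heights of \<open>A\<close> and \<open>J\<close> add up
  to at most \<open>k - 1\<close>, so \<open>J\<close> is a nimber by induction, hence so is \<open>H = *k + J\<close>. If \<open>k = 2 ^ n + 1\<close>, take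
  \<open>i = 2 ^ n - 1\<close>: then \<open>H - A = *k + *i = *(2 ^ (n + 1) - 2)\<close>, which forces the height of \<open>H\<close> to be at
  least \<open>2 ^ n\<close> and that of \<open>J\<close> to be at most \<open>1\<close>, a case that is settled directly.
\<close>

section \<open>The ordered group of games\<close>

lemma lopts_zero [simp]: "lopts zero_game = {||}"
  and ropts_zero [simp]: "ropts zero_game = {||}"
  by (simp_all add: zero_game_def)

lemma game_eqI:
  assumes "\<And>X. X |\<in>| lopts G \<longleftrightarrow> X |\<in>| lopts H" "\<And>X. X |\<in>| ropts G \<longleftrightarrow> X |\<in>| ropts H"
  shows "G = H"
  by (rule game.expand) (use assms in \<open>auto intro!: fset_eqI\<close>)

lemma game_options_induct [case_names step]:
  assumes "\<And>G. (\<And>X. X |\<in>| lopts G \<Longrightarrow> P X) \<Longrightarrow> (\<And>X. X |\<in>| ropts G \<Longrightarrow> P X) \<Longrightarrow> P G"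
  shows "P G"
  by (induction G rule: measure_induct_rule[of size])
     (rule assms, auto intro: size_lopts size_ropts)

lemma lopts_add_iff:
  "X |\<in>| lopts (G \<oplus> H) \<longleftrightarrow>
     (\<exists>A. A |\<in>| lopts G \<and> X = A \<oplus> H) \<or> (\<exists>A. A |\<in>| lopts H \<and> X = G \<oplus> A)"
  by (subst add.simps) auto

lemma ropts_add_iff:
  "X |\<in>| ropts (G \<oplus> H) \<longleftrightarrow>
     (\<exists>A. A |\<in>| ropts G \<and> X = A \<oplus> H) \<or> (\<exists>A. A |\<in>| ropts H \<and> X = G \<oplus> A)"
  by (subst add.simps) auto

lemma left_wins_first_iff: "left_wins_first G \<longleftrightarrow> (\<exists>A. A |\<in>| lopts G \<and> \<not> right_wins_first A)"
  by (subst left_wins_first.simps) auto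

lemma right_wins_first_iff: "right_wins_first G \<longleftrightarrow> (\<exists>A. A |\<in>| ropts G \<and> \<not> left_wins_first A)"
  by (subst right_wins_first.simps) auto

text \<open>Options form genuine sets, so the laws of addition hold as identities of forms and can
  be used for rewriting. Either summand may move, hence the induction on the total size.\<close>

lemma add_commute: "G \<oplus> H = H \<oplus> G"
proof (induction "size G + size H" arbitrary: G H rule: less_induct)
  case less
  have "A \<oplus> H = H \<oplus> A" if "A |\<in>| lopts G \<or> A |\<in>| ropts G" for A
    using that size_lopts[of A G] size_ropts[of A G] by (intro less) auto
  moreover have "G \<oplus> A = A \<oplus> G" if "A |\<in>| lopts H \<or> A |\<in>| ropts H" for A
    using that size_lopts[of A H] size_ropts[of A H] by (intro less) auto
  ultimately show ?case
    by (intro game_eqI; unfold lopts_add_iff ropts_add_iff) metis+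
qed

lemma add_assoc: "G \<oplus> H \<oplus> K = G \<oplus> (H \<oplus> K)"
proof (induction "size G + size H + size K" arbitrary: G H K rule: less_induct)
  case less
  have "A \<oplus> H \<oplus> K = A \<oplus> (H \<oplus> K)" if "A |\<in>| lopts G \<or> A |\<in>| ropts G" for A
    using that size_lopts[of A G] size_ropts[of A G] by (intro less) auto
  moreover have "G \<oplus> A \<oplus> K = G \<oplus> (A \<oplus> K)" if "A |\<in>| lopts H \<or> A |\<in>| ropts H" for A
    using that size_lopts[of A H] size_ropts[of A H] by (intro less) auto
  moreover have "G \<oplus> H \<oplus> A = G \<oplus> (H \<oplus> A)" if "A |\<in>| lopts K \<or> A |\<in>| ropts K" for A
    using that size_lopts[of A K] size_ropts[of A K] by (intro less) auto
  moreover have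
    "X |\<in>| lopts (G \<oplus> H \<oplus> K) \<longleftrightarrow>
       (\<exists>A. A |\<in>| lopts G \<and> X = A \<oplus> H \<oplus> K) \<or> (\<exists>A. A |\<in>| lopts H \<and> X = G \<oplus> A \<oplus> K) \<or>
       (\<exists>A. A |\<in>| lopts K \<and> X = G \<oplus> H \<oplus> A)"
    "X |\<in>| lopts (G \<oplus> (H \<oplus> K)) \<longleftrightarrow>
       (\<exists>A. A |\<in>| lopts G \<and> X = A \<oplus> (H \<oplus> K)) \<or> (\<exists>A. A |\<in>| lopts H \<and> X = G \<oplus> (A \<oplus> K)) \<or>
       (\<exists>A. A |\<in>| lopts K \<and> X = G \<oplus> (H \<oplus> A))"
    "X |\<in>| ropts (G \<oplus> H \<oplus> K) \<longleftrightarrow>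
       (\<exists>A. A |\<in>| ropts G \<and> X = A \<oplus> H \<oplus> K) \<or> (\<exists>A. A |\<in>| ropts H \<and> X = G \<oplus> A \<oplus> K) \<or>
       (\<exists>A. A |\<in>| ropts K \<and> X = G \<oplus> H \<oplus> A)"
    "X |\<in>| ropts (G \<oplus> (H \<oplus> K)) \<longleftrightarrow>
       (\<exists>A. A |\<in>| ropts G \<and> X = A \<oplus> (H \<oplus> K)) \<or> (\<exists>A. A |\<in>| ropts H \<and> X = G \<oplus> (A \<oplus> K)) \<or>
       (\<exists>A. A |\<in>| ropts K \<and> X = G \<oplus> (H \<oplus> A))" for X
    by (auto simp: lopts_add_iff ropts_add_iff)
  ultimately show ?case
    by (intro game_eqI) (simp_all cong: conj_cong)
qed

lemma add_left_commute: "G \<oplus> (H \<oplus> K) = H \<oplus> (G \<oplus> K)"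
  by (metis add_assoc add_commute)

lemmas add_ac = add_assoc add_commute add_left_commute

lemma add_zero [simp]: "G \<oplus> zero_game = G"
proof (induction G rule: game_options_induct)
  case (step G)
  then show ?case
    by (intro game_eqI) (auto simp: lopts_add_iff ropts_add_iff)
qed

section \<open>Negation and strategies in sums\<close>

fun neg :: "game \<Rightarrow> game" where
  "neg G = Game (neg |`| ropts G) (neg |`| lopts G)"

declare neg.simps [simp del]

lemma lopts_neg [simp]: "lopts (neg G) = neg |`| ropts G"
  and ropts_neg [simp]: "ropts (neg G) = neg |`| lopts G"
  by (subst neg.simps, simp)+

lemma neg_zero [simp]: "neg zero_game = zero_game"
  by (intro game_eqI) auto

lemma neg_neg [simp]: "neg (neg G) = G"
proof (induction G rule: game_options_induct)
  case (step G)
  then show ?case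
    by (intro game_eqI) (force simp: image_iff)+
qed

lemma neg_add: "neg (G \<oplus> H) = neg G \<oplus> neg H"
proof (induction "size G + size H" arbitrary: G H rule: less_induct)
  case less
  have 1: "neg (A \<oplus> H) = neg A \<oplus> neg H" if "A |\<in>| lopts G \<or> A |\<in>| ropts G" for A
    using that size_lopts[of A G] size_ropts[of A G] by (intro less) auto
  have 2: "neg (G \<oplus> A) = neg G \<oplus> neg A" if "A |\<in>| lopts H \<or> A |\<in>| ropts H" for A
    using that size_lopts[of A H] size_ropts[of A H] by (intro less) auto
  have "X |\<in>| lopts (neg (G \<oplus> H)) \<longleftrightarrow>
      (\<exists>A. A |\<in>| ropts G \<and> X = neg (A \<oplus> H)) \<or> (\<exists>A. A |\<in>| ropts H \<and> X = neg (G \<oplus> A))"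
    "X |\<in>| ropts (neg (G \<oplus> H)) \<longleftrightarrow>
      (\<exists>A. A |\<in>| lopts G \<and> X = neg (A \<oplus> H)) \<or> (\<exists>A. A |\<in>| lopts H \<and> X = neg (G \<oplus> A))"
    "X |\<in>| lopts (neg G \<oplus> neg H) \<longleftrightarrow>
      (\<exists>A. A |\<in>| ropts G \<and> X = neg A \<oplus> neg H) \<or> (\<exists>A. A |\<in>| ropts H \<and> X = neg G \<oplus> neg A)"
    "X |\<in>| ropts (neg G \<oplus> neg H) \<longleftrightarrow>
      (\<exists>A. A |\<in>| lopts G \<and> X = neg A \<oplus> neg H) \<or> (\<exists>A. A |\<in>| lopts H \<and> X = neg G \<oplus> neg A)" for X
    by (auto simp: lopts_add_iff ropts_add_iff intro!: imageI)
  then show ?case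
    by (intro game_eqI) (simp_all add: 1 2 cong: conj_cong)
qed

lemma wins_first_neg:
  "left_wins_first (neg G) = right_wins_first G \<and> right_wins_first (neg G) = left_wins_first G"
proof (induction G rule: game_options_induct)
  case (step G)
  then show ?case
    by (auto simp: left_wins_first_iff[of "neg G"] right_wins_first_iff[of "neg G"]
        left_wins_first_iff[of G] right_wins_first_iff[of G])
qed

text \<open>Whoever moves second copies each move into the other summand.\<close>

lemma not_wins_first_add_neg: "\<not> left_wins_first (G \<oplus> neg G) \<and> \<not> right_wins_first (G \<oplus> neg G)"
proof (induction G rule: game_options_induct)
  case (step G)
  have "right_wins_first (A \<oplus> neg G)" if "A |\<in>| lopts G" for A
    using that step(1)[OF that] by (subst right_wins_first_iff) (auto simp: ropts_add_iff)
  moreover have "right_wins_first (G \<oplus> neg A)" if "A |\<in>| ropts G" for A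
    using that step(2)[OF that] by (subst right_wins_first_iff) (auto simp: ropts_add_iff)
  moreover have "left_wins_first (A \<oplus> neg G)" if "A |\<in>| ropts G" for A
    using that step(2)[OF that] by (subst left_wins_first_iff) (auto simp: lopts_add_iff)
  moreover have "left_wins_first (G \<oplus> neg A)" if "A |\<in>| lopts G" for A
    using that step(1)[OF that] by (subst left_wins_first_iff) (auto simp: lopts_add_iff)
  ultimately show ?case
    by (auto simp: left_wins_first_iff[of "G \<oplus> neg G"] right_wins_first_iff[of "G \<oplus> neg G"]
        lopts_add_iff ropts_add_iff)
qed

text \<open>Left answers every move of Right in the summand where it was made; if she wins
  \<open>B\<close> moving first, she opens there. Each claim needs the other after one move, so they
  are proved together.\<close>

lemma wins_first_add_nonneg:
  assumes "\<not> right_wins_first A"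
  shows "(\<not> right_wins_first B \<longrightarrow> \<not> right_wins_first (A \<oplus> B)) \<and>
         (left_wins_first B \<longrightarrow> left_wins_first (A \<oplus> B))"
  using assms
proof (induction "size A + size B" arbitrary: A B rule: less_induct)
  case less
  have "left_wins_first (X \<oplus> B)" if X: "X |\<in>| ropts A" and B: "\<not> right_wins_first B" for X
  proof -
    have "left_wins_first X"
      using X less.prems by (auto simp: right_wins_first_iff[of A])
    \<comment> \<open>The roles are exchanged: \<open>B\<close> is now the summand that Left
      survives moving second.\<close>
    then have "left_wins_first (B \<oplus> X)"
      using less.hyps[of B X] X B size_ropts[OF X] by auto
    then show ?thesis by (simp add: add_commute)
  qed
  moreover have "left_wins_first (A \<oplus> X)" if X: "X |\<in>| ropts B" and B: "\<not> right_wins_first B" for X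
  proof -
    have "left_wins_first X"
      using X B by (auto simp: right_wins_first_iff[of B])
    then show ?thesis
      using less.hyps[of A X] less.prems size_ropts[OF X] by auto
  qed
  moreover have "left_wins_first (A \<oplus> B)" if B: "left_wins_first B"
  proof -
    obtain X where X: "X |\<in>| lopts B" "\<not> right_wins_first X"
      using B by (auto simp: left_wins_first_iff[of B])
    then have "\<not> right_wins_first (A \<oplus> X)"
      using less.hyps[of A X] less.prems size_lopts[of X B] by auto
    then show ?thesis
      using X by (auto simp: left_wins_first_iff[of "A \<oplus> B"] lopts_add_iff)
  qed
  ultimately show ?case
    by (auto simp: right_wins_first_iff[of "A \<oplus> B"] ropts_add_iff)
qed

lemma wins_first_add_nonpos:
  assumes "\<not> left_wins_first A"
  shows "(\<not> left_wins_first B \<longrightarrow> \<not> left_wins_first (A \<oplus> B)) \<and>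
         (right_wins_first B \<longrightarrow> right_wins_first (A \<oplus> B))"
  using wins_first_add_nonneg[of "neg A" "neg B"] assms
  by (simp add: wins_first_neg flip: neg_add)

section \<open>Comparison through the difference of two games\<close>

lemma le_iff_wins: "G \<lesssim> H \<longleftrightarrow> \<not> right_wins_first (H \<oplus> neg G)"
proof
  assume "G \<lesssim> H"
  then show "\<not> right_wins_first (H \<oplus> neg G)"
    using not_wins_first_add_neg[of G] by (auto simp: game_le_def outcome_le_def)
next
  assume *: "\<not> right_wins_first (H \<oplus> neg G)"
  \<comment> \<open>Adding \<open>H - G\<close> to \<open>G + X\<close> cannot hurt Left. Regrouped,
    the result is \<open>H + X\<close> with \<open>G - G\<close> added, and \<open>G - G\<close>
    cannot hurt Right.\<close>
  have eq: "(H \<oplus> neg G) \<oplus> (G \<oplus> X) = (G \<oplus> neg G) \<oplus> (H \<oplus> X)" for X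
    by (simp add: add_ac)
  have "outcome_le (G \<oplus> X) (H \<oplus> X)" for X
    using wins_first_add_nonneg[OF *, of "G \<oplus> X"]
      wins_first_add_nonpos[of "G \<oplus> neg G" "H \<oplus> X"] not_wins_first_add_neg[of G]
    unfolding eq outcome_le_def by blast
  then show "G \<lesssim> H"
    by (simp add: game_le_def)
qed

lemma le_iff_wins': "G \<lesssim> H \<longleftrightarrow> \<not> left_wins_first (G \<oplus> neg H)"
  using wins_first_neg[of "G \<oplus> neg H"] by (simp add: le_iff_wins neg_add add_commute)

text \<open>Conway's recursive description of the order: the moves of Right in \<open>H - G\<close>
  lead to \<open>B - G\<close> or to \<open>H - A\<close>.\<close>

lemma le_iff:
  "G \<lesssim> H \<longleftrightarrow> (\<forall>A. A |\<in>| lopts G \<longrightarrow> \<not> H \<lesssim> A) \<and> (\<forall>B. B |\<in>| ropts H \<longrightarrow> \<not> B \<lesssim> G)"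
  unfolding le_iff_wins[of G] right_wins_first_iff[of "H \<oplus> neg G"] ropts_add_iff
  by (auto simp: le_iff_wins')

lemma game_le_refl [simp]: "G \<lesssim> G"
  by (simp add: game_le_def outcome_le_def)

lemma game_le_trans [trans]: "G \<lesssim> H \<Longrightarrow> H \<lesssim> K \<Longrightarrow> G \<lesssim> K"
  unfolding game_le_def outcome_le_def by blast

lemma game_eq_iff_le: "G \<approx> H \<longleftrightarrow> G \<lesssim> H \<and> H \<lesssim> G"
  unfolding game_eq_def game_le_def outcome_le_def by blast

lemma game_le_cong:
  assumes "G \<approx> H"
  shows "K \<lesssim> G \<longleftrightarrow> K \<lesssim> H" "G \<lesssim> K \<longleftrightarrow> H \<lesssim> K"
  using assms game_le_trans[of K G H] game_le_trans[of K H G] game_le_trans[of H G K]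
    game_le_trans[of G H K] by (auto simp: game_eq_iff_le)

lemma game_eq_refl [simp]: "G \<approx> G"
  by (simp add: game_eq_def)

lemma game_eq_sym: "G \<approx> H \<Longrightarrow> H \<approx> G"
  by (simp add: game_eq_def)

lemma game_eq_trans [trans]: "G \<approx> H \<Longrightarrow> H \<approx> K \<Longrightarrow> G \<approx> K"
  by (simp add: game_eq_def)

lemma game_eq_add_right: "G \<approx> H \<Longrightarrow> G \<oplus> K \<approx> H \<oplus> K"
  by (simp add: game_eq_def add_assoc)

lemma game_eq_add: "G \<approx> H \<Longrightarrow> K \<approx> M \<Longrightarrow> G \<oplus> K \<approx> H \<oplus> M"
  by (metis game_eq_add_right add_commute game_eq_trans)

lemma add_neg_eq: "G \<oplus> neg G \<approx> zero_game"
  unfolding game_eq_iff_le le_iff_wins[of zero_game] le_iff_wins'[of _ zero_game]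
  using not_wins_first_add_neg[of G] by simp

lemma neg_le_iff: "neg G \<lesssim> neg H \<longleftrightarrow> H \<lesssim> G"
  by (simp add: le_iff_wins add_commute)

lemma neg_eq_iff: "neg G \<approx> neg H \<longleftrightarrow> G \<approx> H"
  by (auto simp: game_eq_iff_le neg_le_iff)

lemma game_eq_sub:
  assumes "G \<oplus> H \<approx> K"
  shows "G \<approx> K \<oplus> neg H"
proof -
  have "G \<oplus> (H \<oplus> neg H) \<approx> G"
    using game_eq_add[OF game_eq_refl add_neg_eq, of G H] by simp
  then show ?thesis
    using game_eq_add_right[OF assms, of "neg H"] by (metis add_assoc game_eq_sym game_eq_trans)
qed

lemma not_le_lopt: "A |\<in>| lopts G \<Longrightarrow> \<not> G \<lesssim> A"
  using le_iff[of G G] by simp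

lemma not_ropt_le: "A |\<in>| ropts G \<Longrightarrow> \<not> A \<lesssim> G"
  using le_iff[of G G] by simp

section \<open>Heights and canonical forms\<close>

lemma height_le_iff:
  "height G \<le> n \<longleftrightarrow> (\<forall>A. A |\<in>| lopts G \<or> A |\<in>| ropts G \<longrightarrow> height A < n)"
  by (subst height.simps) (auto simp: Suc_le_eq)

lemma height_lopts: "A |\<in>| lopts G \<Longrightarrow> height A < height G"
  and height_ropts: "A |\<in>| ropts G \<Longrightarrow> height A < height G"
  using height_le_iff[of G "height G"] by auto

lemma height_neg [simp]: "height (neg G) = height G"
proof -
  have "height (neg G) \<le> height G" for G
  proof (induction G rule: game_options_induct)
    case (step G)
    then show ?case
      using height_lopts[of _ G] height_ropts[of _ G]
      by (fastforce simp: height_le_iff[of "neg G"])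
  qed
  from this[of G] this[of "neg G"] show ?thesis by simp
qed

lemma height_add_le: "height (G \<oplus> H) \<le> height G + height H"
proof (induction "size G + size H" arbitrary: G H rule: less_induct)
  case less
  have "height (A \<oplus> H) < height G + height H" if "A |\<in>| lopts G \<or> A |\<in>| ropts G" for A
    using that size_lopts[of A G] size_ropts[of A G] less[of A H] height_lopts[of A G]
      height_ropts[of A G] by fastforce
  moreover have "height (G \<oplus> A) < height G + height H" if "A |\<in>| lopts H \<or> A |\<in>| ropts H" for A
    using that size_lopts[of A H] size_ropts[of A H] less[of G A] height_lopts[of A H]
      height_ropts[of A H] by fastforce
  ultimately show ?case
    by (auto simp: height_le_iff[of "G \<oplus> H"] lopts_add_iff ropts_add_iff)
qed

lemma height_eq_0_iff: "height G = 0 \<longleftrightarrow> G = zero_game"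
proof
  assume "height G = 0"
  then show "G = zero_game"
    using height_le_iff[of G 0] by (intro game_eqI) auto
next
  show "G = zero_game \<Longrightarrow> height G = 0"
    using height_le_iff[of zero_game 0] by simp
qed

section \<open>Uniqueness of canonical forms\<close>

lemma neg_neg_mem_iff: "neg X |\<in>| neg |`| S \<longleftrightarrow> X |\<in>| S"
  by (metis fimage_eqI fimageE neg_neg)

lemma right_dominated_neg: "right_dominated G A \<Longrightarrow> left_dominated (neg G) (neg A)"
  unfolding right_dominated_def left_dominated_def
  by (metis lopts_neg neg_neg_mem_iff neg_neg neg_le_iff)

lemma right_reversible_neg: "right_reversible G A \<Longrightarrow> left_reversible (neg G) (neg A)"
  unfolding right_reversible_def left_reversible_def
  by (metis lopts_neg ropts_neg neg_neg_mem_iff neg_le_iff)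

lemma left_dominated_neg: "left_dominated G A \<Longrightarrow> right_dominated (neg G) (neg A)"
  unfolding right_dominated_def left_dominated_def
  by (metis ropts_neg neg_neg_mem_iff neg_neg neg_le_iff)

lemma left_reversible_neg: "left_reversible G A \<Longrightarrow> right_reversible (neg G) (neg A)"
  unfolding right_reversible_def left_reversible_def
  by (metis lopts_neg ropts_neg neg_neg_mem_iff neg_le_iff)

lemma canonical_neg: "canonical G \<Longrightarrow> canonical (neg G)"
proof (induction G rule: game_options_induct)
  case (step G)
  have "\<not> left_dominated (neg G) A" "\<not> left_reversible (neg G) A"
    "\<not> right_dominated (neg G) A" "\<not> right_reversible (neg G) A" for A
    using step.prems left_dominated_neg[of "neg G" A] left_reversible_neg[of "neg G" A]
      right_dominated_neg[of "neg G" A] right_reversible_neg[of "neg G" A]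
    by (auto simp: canonical.simps[of G])
  then show ?case
    using step canonical.simps[of G] by (subst canonical.simps) auto
qed

text \<open>Passing from \<open>G\<close> to \<open>H\<close> and back carries a Left option
  \<open>A\<close> to some \<open>B\<close> above it and on to some \<open>C\<close> above
  \<open>B\<close>. As \<open>G\<close> has no dominated options, \<open>A = C\<close>, so
  \<open>A\<close> and \<open>B\<close> have the same value. The last assumption stands for the
  induction hypothesis of \<open>canonical_unique\<close>.\<close>

lemma canonical_lopts_subset:
  assumes "canonical G" "canonical H" "G \<approx> H"
    and IH: "\<And>A B. A |\<in>| lopts G \<Longrightarrow> B |\<in>| lopts H \<Longrightarrow> A \<approx> B \<Longrightarrow> A = B"
  shows "lopts G |\<subseteq>| lopts H"
proof
  have ex: "\<exists>B. B |\<in>| lopts K \<and> A \<lesssim> B" if "canonical M" "M \<approx> K" "A |\<in>| lopts M" for A K M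
  proof -
    have "\<not> K \<lesssim> A"
      using that game_le_trans not_le_lopt unfolding game_eq_iff_le by blast
    \<comment> \<open>A Right option of \<open>A\<close> below \<open>K\<close> is below
      \<open>M\<close> too, so \<open>A\<close> would be reversible in \<open>M\<close>.\<close>
    moreover have "\<not> B \<lesssim> K" if "B |\<in>| ropts A" for B
      using \<open>canonical M\<close> \<open>A |\<in>| lopts M\<close> \<open>M \<approx> K\<close> that
      unfolding canonical.simps[of M] left_reversible_def game_eq_iff_le
      by (meson game_le_trans)
    ultimately show ?thesis
      by (subst (asm) le_iff) blast
  qed
  fix A assume A: "A |\<in>| lopts G"
  then obtain B where B: "B |\<in>| lopts H" "A \<lesssim> B"
    using ex assms by blast
  then obtain C where C: "C |\<in>| lopts G" "B \<lesssim> C"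
    using ex[of H G B] assms game_eq_sym by blast
  then have "A = C"
    using A B \<open>canonical G\<close> game_le_trans unfolding canonical.simps[of G] left_dominated_def by blast
  then have "A = B"
    using IH A B C by (simp add: game_eq_iff_le)
  then show "A |\<in>| lopts H"
    using B by simp
qed

lemma canonical_unique: "canonical G \<Longrightarrow> canonical H \<Longrightarrow> G \<approx> H \<Longrightarrow> G = H"
proof (induction G arbitrary: H rule: game_options_induct)
  case (step G)
  have options: "canonical A" if "canonical K" "A |\<in>| lopts K \<or> A |\<in>| ropts K" for A K
    using that by (auto simp: canonical.simps[of K])
  have eqL: "A = B" if "A |\<in>| lopts G" "B |\<in>| lopts H" "A \<approx> B" for A B
    using that step options by blast
  \<comment> \<open>Right options are compared as Left options of the negatives, so the one-sided
    lemma suffices.\<close>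
  have eqR: "A = B" if AB: "A |\<in>| lopts (neg G)" "B |\<in>| lopts (neg H)" "A \<approx> B" for A B
  proof -
    obtain A' B' where "A = neg A'" "B = neg B'" "A' |\<in>| ropts G" "B' |\<in>| ropts H"
      using AB by auto
    then show ?thesis
      using step options \<open>A \<approx> B\<close> neg_eq_iff by metis
  qed
  have "lopts G |\<subseteq>| lopts H"
    using canonical_lopts_subset[of G H] eqL step.prems by blast
  moreover have "lopts H |\<subseteq>| lopts G"
    using canonical_lopts_subset[of H G] eqL step.prems game_eq_sym by metis
  moreover have "lopts (neg G) |\<subseteq>| lopts (neg H)"
    using canonical_lopts_subset[of "neg G" "neg H"] eqR step.prems canonical_neg neg_eq_iff by blast
  moreover have "lopts (neg H) |\<subseteq>| lopts (neg G)"
    using canonical_lopts_subset[of "neg H" "neg G"] eqR step.prems canonical_neg neg_eq_iff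
      game_eq_sym by metis
  ultimately show ?case
    by (intro game_eqI) (metis fsubsetD, metis fsubsetD neg_neg_mem_iff lopts_neg)
qed

section \<open>Existence of canonical forms by minimal size\<close>

lemma size_game:
  "size G = Suc ((\<Sum>X\<in>fset (lopts G). Suc (size X)) + (\<Sum>X\<in>fset (ropts G). Suc (size X)))"
  by (cases G) simp

lemma size_neg [simp]: "size (neg G) = size G"
proof (induction G rule: game_options_induct)
  case (step G)
  have "inj_on neg S" for S
    by (metis inj_onI neg_neg)
  then show ?case
    using step by (simp add: size_game[of "neg G"] size_game[of G] sum.reindex)
qed

text \<open>\<open>A\<close> contributes \<open>Suc (size A)\<close> to the size, so even a set
  \<open>T\<close> whose contribution reaches \<open>size A\<close> makes the game smaller.\<close>

lemma size_replace_lopt: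
  assumes "A |\<in>| lopts G" "(\<Sum>X\<in>fset T. Suc (size X)) \<le> size A"
  shows "size (Game (lopts G |-| {|A|} |\<union>| T) (ropts G)) < size G"
proof -
  have "(\<Sum>X\<in>fset (lopts G |-| {|A|} |\<union>| T). Suc (size X))
      \<le> (\<Sum>X\<in>fset (lopts G) - {A}. Suc (size X)) + (\<Sum>X\<in>fset T. Suc (size X))"
    by (simp add: sum_Un_nat)
  also have "\<dots> < (\<Sum>X\<in>fset (lopts G). Suc (size X))"
    using assms by (subst (2) sum.remove[of _ A]) auto
  finally show ?thesis
    by (simp add: size_game[of G])
qed

text \<open>Both games have the same Right options, so only Left options can spoil either
  inequality.\<close>

lemma game_eq_replace_lopts:
  assumes "\<And>X. X |\<in>| L \<Longrightarrow> \<not> G \<lesssim> X"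
    and "\<And>X. X |\<in>| lopts G \<Longrightarrow> \<not> Game L (ropts G) \<lesssim> X"
  shows "Game L (ropts G) \<approx> G"
  unfolding game_eq_iff_le
  by (subst (1 2) le_iff) (use assms not_ropt_le[of _ G] not_ropt_le[of _ "Game L (ropts G)"] in auto)

text \<open>All three claims exchange \<open>A\<close> for a cheaper set \<open>T\<close> without
  changing the value: the empty set if \<open>A\<close> is dominated, the Left options of the
  bypassing position \<open>C\<close> if \<open>A\<close> is reversible, and the single game
  \<open>K\<close> if \<open>K\<close> is a smaller form equal to \<open>A\<close>.\<close>

lemma size_minimal_left:
  assumes min: "\<And>K. K \<approx> G \<Longrightarrow> size G \<le> size K" and A: "A |\<in>| lopts G"
  shows "\<not> left_dominated G A" "\<not> left_reversible G A" "K \<approx> A \<Longrightarrow> size A \<le> size K"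
proof -
  define G' where "G' T = Game (lopts G |-| {|A|} |\<union>| T) (ropts G)" for T
  have lopts_G': "X |\<in>| lopts (G' T) \<longleftrightarrow> X |\<in>| lopts G \<and> X \<noteq> A \<or> X |\<in>| T" for X T
    by (auto simp: G'_def)
  have ropts_G': "ropts (G' T) = ropts G" for T
    by (simp add: G'_def)
  have neq: False if "(\<Sum>X\<in>fset T. Suc (size X)) \<le> size A" "\<And>X. X |\<in>| T \<Longrightarrow> \<not> G \<lesssim> X"
    "\<not> G' T \<lesssim> A" for T
  proof -
    have "G' T \<approx> G"
      unfolding G'_def
      by (rule game_eq_replace_lopts)
        (use that not_le_lopt[of _ G] not_le_lopt[of _ "G' T"] lopts_G'[of _ T] in \<open>auto simp: G'_def\<close>)
    then show False
      using min size_replace_lopt[OF A that(1)] unfolding G'_def by fastforce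
  qed
  show "\<not> left_dominated G A"
  proof
    assume "left_dominated G A"
    then obtain B where "B |\<in>| lopts (G' {||})" "A \<lesssim> B"
      unfolding left_dominated_def lopts_G' by blast
    then show False
      using neq[of "{||}"] not_le_lopt game_le_trans by fastforce
  qed
  show "\<not> left_reversible G A"
  proof
    assume "left_reversible G A"
    then obtain C where C: "C |\<in>| ropts A" "C \<lesssim> G"
      unfolding left_reversible_def by blast
    \<comment> \<open>The Left options of \<open>C\<close> are among those of the new game, and a
      Right option of the new game below \<open>C\<close> would be below \<open>G\<close>. Since
      \<open>C\<close> is a Right option of \<open>A\<close>, the new game cannot be below
      \<open>A\<close>.\<close>
    have "C \<lesssim> G' (lopts C)"
      using C(2) not_le_lopt[of _ "G' (lopts C)"] not_ropt_le[of _ G] game_le_trans[OF _ C(2)]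
      by (subst le_iff) (auto simp: lopts_G' ropts_G')
    then have "\<not> G' (lopts C) \<lesssim> A"
      using C(1) not_ropt_le game_le_trans by blast
    moreover have "(\<Sum>X\<in>fset (lopts C). Suc (size X)) \<le> size A"
      using size_ropts[OF C(1)] size_game[of C] by linarith
    ultimately show False
      using neq[of "lopts C"] C(2) not_le_lopt game_le_trans by blast
  qed
  show "size A \<le> size K" if K: "K \<approx> A"
  proof (rule ccontr)
    assume "\<not> size A \<le> size K"
    moreover have "\<not> G' {|K|} \<lesssim> A"
      using not_le_lopt[of K "G' {|K|}"] K game_le_trans unfolding lopts_G' game_eq_iff_le by blast
    moreover have "\<not> G \<lesssim> K"
      using K A not_le_lopt game_le_trans unfolding game_eq_iff_le by blast
    ultimately show False
      using neq[of "{|K|}"] by auto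
  qed
qed

text \<open>Deleting a dominated option and bypassing a reversible one both decrease the size.\<close>

lemma canonical_of_size_minimal:
  "(\<And>K. K \<approx> G \<Longrightarrow> size G \<le> size K) \<Longrightarrow> canonical G"
proof (induction G rule: game_options_induct)
  case (step G)
  have min: "size (neg G) \<le> size K" if "K \<approx> neg G" for K
    using step.prems[of "neg K"] that neg_eq_iff[of K "neg G"] by simp
  have L: "\<not> left_dominated G A" "\<not> left_reversible G A" for A
    using size_minimal_left[OF step.prems, of A] by (auto simp: left_dominated_def left_reversible_def)
  have R: "\<not> left_dominated (neg G) A" "\<not> left_reversible (neg G) A" for A
    using size_minimal_left[OF min, of A] by (auto simp: left_dominated_def left_reversible_def)
  have "canonical A" if "A |\<in>| lopts G" for A
    using step.IH(1)[OF that] size_minimal_left(3)[OF step.prems that] by blast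
  moreover have "canonical A" if "A |\<in>| ropts G" for A
  proof (rule step.IH(2)[OF that])
    fix K assume "K \<approx> A"
    then show "size A \<le> size K"
      using size_minimal_left(3)[OF min, of "neg A" "neg K"] that neg_eq_iff by simp
  qed
  ultimately show ?case
    using L R right_dominated_neg right_reversible_neg by (subst canonical.simps) blast
qed

text \<open>A form of least size among those equal to \<open>G\<close> is canonical, so the definite
  description in \<open>canonical_form\<close> denotes.\<close>

lemma canonical_form_props: "canonical (canonical_form G) \<and> canonical_form G \<approx> G"
proof -
  obtain K where K: "K \<approx> G" "\<And>M. M \<approx> G \<Longrightarrow> size K \<le> size M"
    using ex_has_least_nat[of "\<lambda>K. K \<approx> G" G size] by auto
  then have "canonical K"
    by (intro canonical_of_size_minimal) (blast intro: game_eq_trans)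
  then have "\<exists>!K. canonical K \<and> K \<approx> G"
    using K(1) canonical_unique game_eq_sym game_eq_trans by blast
  then show ?thesis
    unfolding canonical_form_def by (rule theI')
qed

lemma birthday_canonical: "canonical G \<Longrightarrow> birthday G = height G"
  unfolding birthday_def using canonical_form_props[of G] canonical_unique by metis

section \<open>Nimbers\<close>

lemma lopts_nimber [simp]: "X |\<in>| lopts (nimber k) \<longleftrightarrow> (\<exists>i<k. X = nimber i)"
  and ropts_nimber [simp]: "X |\<in>| ropts (nimber k) \<longleftrightarrow> (\<exists>i<k. X = nimber i)"
  by (auto simp: nimber.simps[of k] fset_of_list_elem)

lemma nimber_0 [simp]: "nimber 0 = zero_game"
  by (intro game_eqI) auto

lemma neg_nimber [simp]: "neg (nimber k) = nimber k"
proof (induction k rule: less_induct)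
  case (less k)
  then show ?case
    by (intro game_eqI; unfold lopts_neg ropts_neg fimage_iff) force+
qed

text \<open>Of two different nimbers the smaller is both a Left and a Right option of the larger,
  which rules out both inequalities.\<close>

lemma nimber_le_iff [simp]: "nimber i \<lesssim> nimber j \<longleftrightarrow> i = j"
  by (metis game_le_refl lopts_nimber not_le_lopt not_ropt_le ropts_nimber linorder_neqE_nat)

lemma nimber_eq_iff: "nimber i \<approx> nimber j \<longleftrightarrow> i = j"
  by (auto simp: game_eq_iff_le)

lemma height_nimber [simp]: "height (nimber k) = k"
proof (induction k rule: less_induct)
  case (less k)
  then have "height (nimber k) \<le> n \<longleftrightarrow> k \<le> n" for n
    by (auto simp: height_le_iff) (metis less_irrefl not_le_imp_less)
  then show ?case
    by (metis le_antisym order_refl)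
qed

lemma canonical_nimber: "canonical (nimber k)"
proof (induction k rule: less_induct)
  case (less k)
  then show ?case
    by (subst canonical.simps)
       (auto simp: left_dominated_def right_dominated_def left_reversible_def right_reversible_def)
qed

lemma birthday_nimber: "birthday (nimber k) = k"
  by (simp add: birthday_canonical canonical_nimber)

section \<open>Nim addition as bitwise exclusive or\<close>

lemma xor_double:
  fixes a b x y :: nat
  assumes "a < 2" "b < 2"
  shows "xor (2 * x + a) (2 * y + b) = 2 * xor x y + (a + b) mod 2"
proof -
  have "a = 0 \<or> a = 1" "b = 0 \<or> b = 1" using assms by auto
  then show ?thesis
    by (subst xor_nat_rec) auto
qed

text \<open>The move in Nim that lowers the nim-sum to \<open>t\<close>. If the half of
  \<open>t\<close> is below that of the nim-sum, induction lowers a half of \<open>a\<close> or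
  \<open>b\<close> and the last bit is adjusted; otherwise \<open>t\<close> only lacks the last bit,
  which is cleared in the odd one of \<open>a\<close> and \<open>b\<close>.\<close>

lemma xor_less_cases:
  fixes a b t :: nat
  assumes "t < xor a b"
  shows "(\<exists>a'<a. xor a' b = t) \<or> (\<exists>b'<b. xor a b' = t)"
  using assms
proof (induction "a + b" arbitrary: a b t rule: less_induct)
  case less
  define x y u where "x = a div 2" and "y = b div 2" and "u = t div 2"
  define p q r where "p = a mod 2" and "q = b mod 2" and "r = t mod 2"
  have a: "a = 2 * x + p" and b: "b = 2 * y + q" and t: "t = 2 * u + r"
    and bits: "p < 2" "q < 2" "r < 2"
    by (simp_all add: x_def y_def u_def p_def q_def r_def)
  have *: "xor a b = 2 * xor x y + (p + q) mod 2"
    unfolding a b using bits xor_double by blast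
  show ?case
  proof (cases "u < xor x y")
    case True
    then have "x + y \<noteq> 0"
      by (metis add_is_0 not_less0 xor_self_eq)
    then have "x + y < a + b"
      using a b by linarith
    then consider x' where "x' < x" "xor x' y = u" | y' where "y' < y" "xor x y' = u"
      using less.hyps True by blast
    then show ?thesis
    proof cases
      case 1
      \<comment> \<open>The last bit \<open>(r + q) mod 2\<close> yields \<open>r\<close> against
        \<open>q\<close>; the drop from \<open>x\<close> to \<open>x'\<close> outweighs it.\<close>
      have "((r + q) mod 2 + q) mod 2 = r"
        using bits by (auto simp: less_2_cases_iff)
      then have "xor (2 * x' + (r + q) mod 2) b = t" "2 * x' + (r + q) mod 2 < a"
        using 1 xor_double[of "(r + q) mod 2" q x' y] bits mod_less_divisor[of 2 "r + q"]
        unfolding a b t by linarith+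
      then show ?thesis by blast
    next
      case 2
      have "(p + (r + p) mod 2) mod 2 = r"
        using bits by (auto simp: less_2_cases_iff)
      then have "xor a (2 * y' + (r + p) mod 2) = t" "2 * y' + (r + p) mod 2 < b"
        using 2 xor_double[of p "(r + p) mod 2" x y'] bits mod_less_divisor[of 2 "r + p"]
        unfolding a b t by linarith+
      then show ?thesis by blast
    qed
  next
    case False
    then have eq: "u = xor x y" "r = 0" "(p + q) mod 2 = 1"
      using less.prems * t bits by (auto simp: less_2_cases_iff)
    then consider "p = 1" "q = 0" | "p = 0" "q = 1"
      using bits by (auto simp: less_2_cases_iff)
    then show ?thesis
    proof cases
      case 1
      then have "xor (2 * x) b = t" "2 * x < a"
        using xor_double[of 0 q x y] eq a b t by auto
      then show ?thesis by blast
    next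
      case 2
      then have "xor a (2 * y) = t" "2 * y < b"
        using xor_double[of p 0 x y] eq a b t by auto
      then show ?thesis by blast
    qed
  qed
qed

lemma xor_left_cancel:
  fixes a b c :: nat
  shows "xor a b = xor a c \<longleftrightarrow> b = c"
proof
  assume "xor a b = xor a c"
  then have "xor (xor a a) b = xor (xor a a) c"
    by (simp only: xor.assoc)
  then show "b = c" by simp
qed simp

text \<open>By cancellation the value of every option differs from \<open>xor a b\<close> and so is
  incomparable with it, while \<open>xor_less_cases\<close> supplies every smaller nimber as an
  option.\<close>

lemma nimber_add: "nimber a \<oplus> nimber b \<approx> nimber (xor a b)"
proof (induction "a + b" arbitrary: a b rule: less_induct)
  case less
  let ?S = "nimber a \<oplus> nimber b"
  have L: "nimber a' \<oplus> nimber b \<approx> nimber (xor a' b)" if "a' < a" for a'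
    using less that by simp
  have R: "nimber a \<oplus> nimber b' \<approx> nimber (xor a b')" if "b' < b" for b'
    using less that by simp
  have inj: "xor a' b = xor a b \<longleftrightarrow> a' = a" "xor a b' = xor a b \<longleftrightarrow> b' = b" for a' b'
    using xor_left_cancel[of b a' a] xor_left_cancel[of a b' b]
    by (simp_all only: xor.commute[of b])
  have "?S \<lesssim> nimber (xor a b)"
  proof (subst le_iff, intro conjI allI impI)
    fix A assume "A |\<in>| lopts ?S"
    then consider a' where "a' < a" "A = nimber a' \<oplus> nimber b"
      | b' where "b' < b" "A = nimber a \<oplus> nimber b'"
      unfolding lopts_add_iff by auto
    then obtain c where "A \<approx> nimber c" "c \<noteq> xor a b"
    proof cases
      case 1
      then show ?thesis using L[of a'] inj(1)[of a'] that by simp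
    next
      case 2
      then show ?thesis using R[of b'] inj(2)[of b'] that by simp
    qed
    then show "\<not> nimber (xor a b) \<lesssim> A"
      by (simp add: game_le_cong)
  next
    fix B assume "B |\<in>| ropts (nimber (xor a b))"
    then obtain t where t: "t < xor a b" "B = nimber t" by auto
    consider a' where "a' < a" "xor a' b = t" | b' where "b' < b" "xor a b' = t"
      using xor_less_cases[OF t(1)] by auto
    then obtain A where "A |\<in>| ropts ?S" "A \<approx> nimber t"
    proof cases
      case 1
      then have "nimber a' \<oplus> nimber b |\<in>| ropts ?S"
        unfolding ropts_add_iff by auto
      then show ?thesis using L[of a'] 1 that by simp
    next
      case 2
      then have "nimber a \<oplus> nimber b' |\<in>| ropts ?S"
        unfolding ropts_add_iff by auto
      then show ?thesis using R[of b'] 2 that by simp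
    qed
    then show "\<not> B \<lesssim> ?S"
      using t(2) not_ropt_le game_le_cong(2) by blast
  qed
  \<comment> \<open>Both sides are their own negatives, and negation reverses the
    inequality.\<close>
  moreover from this have "nimber (xor a b) \<lesssim> ?S"
    using neg_le_iff[of "nimber (xor a b)" ?S] by (simp add: neg_add)
  ultimately show ?case
    by (simp add: game_eq_iff_le)
qed

lemma xor_pow2:
  fixes m :: nat
  shows "m < 2 ^ n \<Longrightarrow> xor (2 ^ n) m = 2 ^ n + m"
proof (induction n arbitrary: m)
  case (Suc n)
  then have "xor (2 * 2 ^ n + 0) (2 * (m div 2) + m mod 2) = 2 * (2 ^ n + m div 2) + m mod 2"
    by (subst xor_double) auto
  then show ?case
    by simp
qed simp

text \<open>The numbers \<open>2 ^ n + 1\<close> and \<open>2 ^ n - 1\<close> share exactly the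
  lowest bit.\<close>

lemma xor_pow2_neighbours:
  assumes "n \<ge> 1"
  shows "xor (2 ^ n + 1) (2 ^ n - 1) = (2 ^ (n + 1) - 2 :: nat)"
proof -
  obtain l where n: "n = Suc l"
    using assms by (cases n) auto
  have "(2::nat) ^ n - 1 = 2 * (2 ^ l - 1) + 1"
    unfolding n power_Suc using one_le_power[of "2::nat" l] by linarith
  then have "xor (2 ^ n + 1) (2 ^ n - 1) = 2 * xor (2 ^ l) (2 ^ l - 1 :: nat)"
    using xor_double[of 1 1 "2 ^ l" "2 ^ l - 1"] n by simp
  then show ?thesis
    using xor_pow2[of "2 ^ l - 1" l] n by simp
qed

section \<open>Decompositions of nimbers\<close>

text \<open>Only an option \<open>A >= *i\<close> can refute \<open>X <= *i\<close>, as
  \<open>*j <= X\<close> would give \<open>*j <= *k\<close>. Either \<open>A\<close> equals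
  \<open>*i\<close>, and for positive \<open>i\<close> the induction descends to
  \<open>i - 1\<close>, or \<open>A\<close> has a Right option \<open>B <= *k\<close>, which
  inherits the assumptions and lies two moves deeper.\<close>

lemma less_height_if_le_nimber:
  assumes "i < k" "X \<lesssim> nimber k" "\<not> X \<lesssim> nimber i"
  shows "i < height X"
  using assms
proof (induction X arbitrary: i k rule: measure_induct_rule[of size])
  case (less X)
  obtain A where A: "A |\<in>| lopts X" "nimber i \<lesssim> A"
  proof -
    have "\<not> nimber j \<lesssim> X" if "j < i" for j
      using game_le_trans[of "nimber j" X "nimber k"] less.prems that by auto
    then show ?thesis
      using less.prems(3) that le_iff[of X "nimber i"] by auto
  qed
  have hA: "height A < height X"
    using A(1) by (rule height_lopts)
  have "\<not> nimber k \<lesssim> A"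
    using A not_le_lopt less.prems game_le_trans by blast
  then consider j where "j < k" "A \<lesssim> nimber j" | B where "B |\<in>| ropts A" "B \<lesssim> nimber k"
    unfolding le_iff[of "nimber k" A] by auto
  then show ?case
  proof cases
    case 1
    then have Ai: "A \<lesssim> nimber i"
      using A game_le_trans nimber_le_iff by metis
    show ?thesis
    proof (cases i)
      case 0
      then show ?thesis using hA by simp
    next
      case (Suc l)
      then have "\<not> A \<lesssim> nimber l"
        using A game_le_trans nimber_le_iff by (metis n_not_Suc_n)
      then have "l < height A"
        using less.IH[OF size_lopts[OF A(1)] _ Ai] Suc by simp
      then show ?thesis using hA Suc by simp
    qed
  next
    case 2
    have "\<not> B \<lesssim> nimber i"
      using 2 A not_ropt_le game_le_trans by blast
    then have "i < height B"
      using less.IH[OF _ less.prems(1) 2(2)] size_ropts[OF 2(1)] size_lopts[OF A(1)] by simp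
    then show ?thesis
      using hA height_ropts[OF 2(1)] by simp
  qed
qed

lemma height_ge_nimber:
  assumes "X \<approx> nimber k"
  shows "k \<le> height X"
proof (cases k)
  case (Suc l)
  then have "\<not> X \<lesssim> nimber l"
    using assms game_le_trans nimber_le_iff unfolding game_eq_iff_le by (metis n_not_Suc_n)
  then show ?thesis
    using less_height_if_le_nimber[of l k X] assms Suc by (simp add: game_eq_iff_le)
qed simp

lemma ex_lopt_nimber:
  assumes "G \<approx> nimber k" "i < k" "height G \<le> i + 2"
  obtains A where "A |\<in>| lopts G" "A \<approx> nimber i"
proof -
  have G: "G \<lesssim> nimber k" "nimber k \<lesssim> G"
    using assms by (auto simp: game_eq_iff_le)
  have "\<not> G \<lesssim> nimber i"
    using G assms game_le_trans nimber_le_iff less_irrefl by metis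
  moreover have "\<not> nimber j \<lesssim> G" if "j < i" for j
    using game_le_trans[OF _ G(1), of "nimber j"] assms that by auto
  ultimately obtain A where A: "A |\<in>| lopts G" "nimber i \<lesssim> A"
    using le_iff[of G "nimber i"] by auto
  have "\<not> nimber k \<lesssim> A"
    using A not_le_lopt G game_le_trans by blast
  moreover have "\<not> B \<lesssim> nimber k" if B: "B |\<in>| ropts A" for B
  proof
    assume "B \<lesssim> nimber k"
    moreover have "\<not> B \<lesssim> nimber i"
      using B A not_ropt_le game_le_trans by blast
    ultimately have "i < height B"
      using less_height_if_le_nimber assms(2) by blast
    \<comment> \<open>\<open>B\<close> lies two moves below \<open>G\<close>, so the bound
      \<open>i + 2\<close> leaves it a height of at most \<open>i\<close>.\<close>
    then show False
      using height_ropts[OF B] height_lopts[OF A(1)] assms(3) by simp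
  qed
  ultimately obtain j where "A \<lesssim> nimber j"
    unfolding le_iff[of "nimber k" A] by auto
  then have "A \<lesssim> nimber i"
    using A game_le_trans nimber_le_iff by metis
  then show ?thesis
    using A that by (simp add: game_eq_iff_le)
qed

lemma ex_ropt_nimber:
  assumes "G \<approx> nimber k" "i < k" "height G \<le> i + 2"
  obtains A where "A |\<in>| ropts G" "A \<approx> nimber i"
proof -
  have "neg G \<approx> nimber k"
    using assms(1) neg_eq_iff[of G "nimber k"] by simp
  then obtain A where "A |\<in>| lopts (neg G)" "A \<approx> nimber i"
    using ex_lopt_nimber[of "neg G" k i] assms by auto
  then obtain B where "B |\<in>| ropts G" "neg B \<approx> nimber i"
    by auto
  then show ?thesis
    using that neg_eq_iff[of B "nimber i"] by simp
qed

section \<open>Recognising a summand as a nimber\<close>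

lemma equals_nimber_if_add:
  assumes "H \<oplus> J \<approx> nimber k" "equals_nimber J"
  shows "equals_nimber H"
proof -
  obtain m where "J \<approx> nimber m"
    using assms unfolding equals_nimber_def by blast
  then have "neg J \<approx> nimber m"
    using neg_eq_iff[of J "nimber m"] by simp
  then have "nimber k \<oplus> neg J \<approx> nimber k \<oplus> nimber m"
    by (rule game_eq_add[OF game_eq_refl])
  note game_eq_sub[OF assms(1)]
  also note \<open>nimber k \<oplus> neg J \<approx> nimber k \<oplus> nimber m\<close>
  also note nimber_add
  finally show ?thesis
    unfolding equals_nimber_def by blast
qed

lemma equals_nimber_add_iff: "H \<oplus> J \<approx> nimber k \<Longrightarrow> equals_nimber H \<longleftrightarrow> equals_nimber J"
  using equals_nimber_if_add[of H J] equals_nimber_if_add[of J H] add_commute[of H J] by auto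

text \<open>Right cannot move in \<open>J\<close>, so his move to the next smaller nimber takes
  place in \<open>H\<close>, and \<open>k\<close> such moves in a row need height \<open>k\<close>.
  As \<open>J\<close> has height at most one, a too low \<open>H\<close> keeps the sum low enough
  for \<open>ex_ropt_nimber\<close>.\<close>

lemma height_ge_if_no_ropts:
  assumes "H \<oplus> J \<approx> nimber k" "ropts J = {||}" "height J \<le> 1"
  shows "k \<le> height H"
  using assms(1)
proof (induction k arbitrary: H)
  case (Suc k)
  show ?case
  proof (rule ccontr)
    assume "\<not> Suc k \<le> height H"
    then have "height (H \<oplus> J) \<le> k + 2"
      using height_add_le[of H J] assms(3) by simp
    then obtain A where "A |\<in>| ropts (H \<oplus> J)" "A \<approx> nimber k"
      using ex_ropt_nimber[OF Suc.prems, of k] by auto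
    then obtain B where "B |\<in>| ropts H" "B \<oplus> J \<approx> nimber k"
      using assms(2) by (auto simp: ropts_add_iff)
    then show False
      using Suc.IH height_ropts \<open>\<not> Suc k \<le> height H\<close> by fastforce
  qed
qed simp

text \<open>The forms of height one are \<open>1\<close>, \<open>-1\<close> and \<open>*1\<close>.
  For the first two some player can move only in \<open>H\<close>, which then takes up the whole
  height \<open>k\<close> and leaves none for \<open>J\<close>.\<close>

lemma equals_nimber_if_height_le_1:
  assumes HJ: "H \<oplus> J \<approx> nimber k" "height H + height J \<le> k" and J: "height J \<le> 1"
  shows "equals_nimber J"
proof -
  have zero: "equals_nimber J" if "height J = 0"
    using that height_eq_0_iff nimber_0 game_eq_refl unfolding equals_nimber_def by metis
  consider "ropts J = {||}" | "lopts J = {||}" | "ropts J \<noteq> {||}" "lopts J \<noteq> {||}"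
    by blast
  then show ?thesis
  proof cases
    case 1
    then show ?thesis
      using height_ge_if_no_ropts[OF HJ(1)] HJ(2) J zero by simp
  next
    case 2
    have "neg H \<oplus> neg J \<approx> nimber k"
      using HJ(1) neg_eq_iff[of "H \<oplus> J" "nimber k"] by (simp add: neg_add)
    then show ?thesis
      using height_ge_if_no_ropts[of "neg H" "neg J" k] 2 HJ(2) J zero by simp
  next
    case 3
    have "X = zero_game" if "X |\<in>| lopts J \<or> X |\<in>| ropts J" for X
      using that J height_le_iff[of J 1] height_eq_0_iff by auto
    then have "J = nimber 1"
      using 3 by (intro game_eqI) auto
    then show ?thesis
      unfolding equals_nimber_def using game_eq_refl by blast
  qed
qed

lemma equals_nimber_pow2_Suc:
  assumes HJ: "H \<oplus> J \<approx> nimber (2 ^ n + 1)" "height H + height J \<le> 2 ^ n + 1" and n: "n \<ge> 1"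
    and A: "A |\<in>| lopts H" "A \<oplus> J \<approx> nimber (2 ^ n - 1)"
  shows "equals_nimber J"
proof -
  have "neg A \<oplus> neg J \<approx> nimber (2 ^ n - 1)"
    using A(2) neg_eq_iff[of "A \<oplus> J" "nimber (2 ^ n - 1)"] by (simp add: neg_add)
  then have "(H \<oplus> J) \<oplus> (neg A \<oplus> neg J) \<approx> nimber (xor (2 ^ n + 1) (2 ^ n - 1))"
    by (rule game_eq_trans[OF game_eq_add[OF HJ(1)] nimber_add])
  moreover have "(H \<oplus> J) \<oplus> (neg A \<oplus> neg J) = (H \<oplus> neg A) \<oplus> (J \<oplus> neg J)"
    by (metis add_assoc add_left_commute)
  ultimately have "(H \<oplus> neg A) \<oplus> (J \<oplus> neg J) \<approx> nimber (2 ^ (n + 1) - 2)"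
    by (simp only: xor_pow2_neighbours[OF n])
  moreover have "H \<oplus> neg A \<approx> (H \<oplus> neg A) \<oplus> (J \<oplus> neg J)"
    using game_eq_add[OF game_eq_refl game_eq_sym[OF add_neg_eq], of "H \<oplus> neg A" J] by simp
  ultimately have "H \<oplus> neg A \<approx> nimber (2 ^ (n + 1) - 2)"
    using game_eq_trans by blast
  then have "2 ^ (n + 1) - 2 \<le> height (H \<oplus> neg A)"
    by (rule height_ge_nimber)
  then have "2 ^ (n + 1) - 2 \<le> height H + height A"
    using height_add_le[of H "neg A"] by simp
  \<comment> \<open>Since \<open>height A < height H\<close>, the bound gives
    \<open>2 * height H >= 2 ^ (n + 1) - 1\<close>, and by parity
    \<open>height H >= 2 ^ n\<close>.\<close>
  then have "height J \<le> 1"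
    using height_lopts[OF A(1)] HJ(2) by simp
  then show ?thesis
    using equals_nimber_if_height_le_1 HJ by blast
qed

text \<open>Stated for arbitrary forms and with an inequality, because replacing a summand by an
  option may lower its height by more than one.\<close>

lemma summands_equal_nimbers:
  assumes "H \<oplus> J \<approx> nimber k" "height H + height J \<le> k" "\<nexists>n. k = 2 ^ n"
  shows "equals_nimber H \<and> equals_nimber J"
  using assms
proof (induction k arbitrary: H J)
  case 0
  then show ?case
    using equals_nimber_if_height_le_1[of H J 0] equals_nimber_add_iff[of H J 0] by simp
next
  case (Suc k)
  have height: "height (H \<oplus> J) \<le> Suc k"
    using height_add_le[of H J] Suc.prems(2) by simp
  \<comment> \<open>One summand is enough: the other is then a difference of nimbers.\<close>
  have "equals_nimber H \<or> equals_nimber J"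
  proof (cases "\<exists>n. k = 2 ^ n")
    case False
    obtain A where "A |\<in>| lopts (H \<oplus> J)" "A \<approx> nimber k"
      using ex_lopt_nimber[OF Suc.prems(1), of k] height by auto
    then consider B where "B |\<in>| lopts H" "B \<oplus> J \<approx> nimber k"
      | B where "B |\<in>| lopts J" "H \<oplus> B \<approx> nimber k"
      by (auto simp: lopts_add_iff)
    then show ?thesis
    proof cases
      case 1
      then show ?thesis
        using Suc.IH[of B J] False height_lopts[of B H] Suc.prems(2) by simp
    next
      case 2
      then show ?thesis
        using Suc.IH[of H B] False height_lopts[of B J] Suc.prems(2) by simp
    qed
  next
    case True
    then obtain n where n: "k = 2 ^ n" by blast
    \<comment> \<open>\<open>equals_nimber_pow2_Suc\<close> needs \<open>n >= 1\<close>;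
      \<open>k = 1\<close> is excluded because its successor is a power of two.\<close>
    have "n \<noteq> 0"
    proof
      assume "n = 0"
      then have "Suc k = 2 ^ 1"
        using n by simp
      then show False
        using Suc.prems(3) by blast
    qed
    \<comment> \<open>Here \<open>i + 2\<close> is exactly \<open>Suc k\<close>, so
      \<open>2 ^ n - 1\<close> is the smallest index that the height bound permits.\<close>
    obtain A where "A |\<in>| lopts (H \<oplus> J)" "A \<approx> nimber (2 ^ n - 1)"
      using ex_lopt_nimber[OF Suc.prems(1), of "2 ^ n - 1"] height n diff_less_Suc by auto
    then consider B where "B |\<in>| lopts H" "B \<oplus> J \<approx> nimber (2 ^ n - 1)"
      | B where "B |\<in>| lopts J" "B \<oplus> H \<approx> nimber (2 ^ n - 1)"
      by (auto simp: lopts_add_iff add_commute)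
    then show ?thesis
    proof cases
      case 1
      then show ?thesis
        using equals_nimber_pow2_Suc[of H J n B] Suc.prems n \<open>n \<noteq> 0\<close> by simp
    next
      case 2
      then show ?thesis
        using equals_nimber_pow2_Suc[of J H n B] Suc.prems n \<open>n \<noteq> 0\<close>
        by (simp add: add_commute)
    qed
  qed
  then show ?case
    using equals_nimber_add_iff[OF Suc.prems(1)] by blast
qed

text \<open>Split off the leading bit of \<open>k\<close>: the two parts have no bit in common, so
  their nim-sum is their ordinary sum and the birthdays add up. The remainder is nonzero because
  \<open>k\<close> is not a power of two.\<close>

lemma strong_decomposition_nimber:
  assumes "k \<noteq> 0" "\<nexists>n. k = 2 ^ n"
  obtains a b where "strong_decomposition (nimber k) (nimber a) (nimber b)"
proof -
  obtain n where n: "2 ^ n \<le> k" "k < 2 ^ (n + 1)"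
    using ex_power_ivl1[of 2 k] assms(1) by auto
  define m where "m = k - 2 ^ n"
  have k: "k = 2 ^ n + m" "m < 2 ^ n"
    using n by (auto simp: m_def)
  then have "m \<noteq> 0"
    using assms(2) by (metis add_0_right)
  have "strong_decomposition (nimber k) (nimber (2 ^ n)) (nimber m)"
    using k \<open>m \<noteq> 0\<close> nimber_add[of "2 ^ n" m] xor_pow2[of m n] nimber_eq_iff[of _ 0]
    by (simp add: strong_decomposition_def birthday_nimber game_eq_sym)
  then show ?thesis
    by (rule that)
qed

text \<open>Decomposability fails at \<open>k = 0\<close>: birthdays adding up to 0 force both
  summands to be zero.\<close>

theorem theorem26:
  fixes k :: nat
  assumes "\<not> (\<exists>n::nat. k = 2 ^ n)"
  shows "(k \<noteq> 0 \<longrightarrow> strongly_decomposable (nimber k)) \<and>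
         (\<forall>H J. strong_decomposition (nimber k) H J \<longrightarrow> equals_nimber H \<and> equals_nimber J)"
proof (intro conjI impI allI)
  assume "k \<noteq> 0"
  then show "strongly_decomposable (nimber k)"
    using strong_decomposition_nimber[OF _ assms] unfolding strongly_decomposable_def by metis
next
  fix H J
  assume "strong_decomposition (nimber k) H J"
  then have HJ: "birthday H + birthday J = k" "nimber k \<approx> H \<oplus> J"
    by (auto simp: strong_decomposition_def birthday_nimber)
  \<comment> \<open>Passing to canonical forms turns birthdays into heights of actual summands
    without changing values.\<close>
  have cf: "canonical_form H \<approx> H" "canonical_form J \<approx> J"
    using canonical_form_props by auto
  then have "canonical_form H \<oplus> canonical_form J \<approx> nimber k"
    using game_eq_trans[OF game_eq_add[OF cf] game_eq_sym[OF HJ(2)]] by simp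
  then have "equals_nimber (canonical_form H) \<and> equals_nimber (canonical_form J)"
    using summands_equal_nimbers HJ(1) assms by (simp add: birthday_def)
  then have "equals_nimber H" "equals_nimber J"
    using cf game_eq_sym game_eq_trans unfolding equals_nimber_def by blast+
  then show "equals_nimber H" "equals_nimber J"
    by simp_all
qed

end
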